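(* Let $k\ge 1$ and $N$ be integers with $N\geq 3k$. Then for every unitary operator $U$ on $\mathbb{C}^N$ with $N$ distinct eigenvalues one has $\Omega_k(U)=\Delta_k(U)$. Hence, for every unitary operator $U$ on $\mathbb{C}^N$ with $N$ distinct eigenvalues, $\Lambda_k(U)=\Omega_k(U)$.
   Context: Let $T$ be an operator on $\mathbb{C}^N$ with eigenvalues $\lambda_1,\dots,\lambda_N$ (listed with multiplicity), and let $1\le k\le N$. $\Lambda_k(T)$ is the $k$th (higher-rank) numerical range: the set of $\lambda\in\mathbb{C}$ such that $PTP=\lambda P$ for some orthogonal projection $P$ of rank $k$. $\Omega_k(T)=\bigcap_{S}\operatorname{conv}\{\lambda_j: j\in S\}$, where $S$ runs over all subsets of $\{1,\dots,N\}$ with exactly $N-k+1$ elements. For unitary $U$, $\Delta_k(U)$ is the set of $\lambda\in\mathbb{C}$ for which there exist $k$ pairwise disjoint subsets $S_1,\dots,S_k$ of $\{1,\dots,N\}$ with $\lambda\in\operatorname{conv}\{\lambda_j:j\in S_i\}$ for each $i=1,\dots,k$ (with $\operatorname{conv}\emptyset=\emptyset$). *)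

theory Defs
  imports
    "HOL-Analysis.Analysis"
    "Jordan_Normal_Form.Spectral_Radius"
    "Jordan_Normal_Form.DL_Rank"
begin

(* Operators on C^N are complex matrices in carrier_mat N N; the subscript N is recovered
   from the matrix as dim_row. *)

definition unitary_mat :: "complex mat \<Rightarrow> bool" where
  "unitary_mat U \<longleftrightarrow>
     square_mat U \<and>
     mat_adjoint U * U = 1\<^sub>m (dim_row U) \<and>
     U * mat_adjoint U = 1\<^sub>m (dim_row U)"

definition orthogonal_projection :: "complex mat \<Rightarrow> bool" where
  "orthogonal_projection P \<longleftrightarrow> square_mat P \<and> P * P = P \<and> mat_adjoint P = P"

(* An enumeration of the eigenvalues with algebraic multiplicity, in an arbitrary order;
   Omega and Delta below do not depend on the order. *)
definition eigval_list :: "complex mat \<Rightarrow> complex list" where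
  "eigval_list T = (SOME es. char_poly T = (\<Prod>e\<leftarrow>es. [:- e, 1:]))"

lemma eigval_list:
  assumes T: "T \<in> carrier_mat N N"
  shows char_poly_eigval_list: "char_poly T = (\<Prod>e\<leftarrow>eigval_list T. [:- e, 1:])"
    and length_eigval_list: "length (eigval_list T) = N"
    and set_eigval_list: "set (eigval_list T) = spectrum T"
proof -
  from char_poly_factorized[OF T] have "\<exists>es. char_poly T = (\<Prod>e\<leftarrow>es. [:- e, 1:])"
    by blast
  then show *: "char_poly T = (\<Prod>e\<leftarrow>eigval_list T. [:- e, 1:])"
    unfolding eigval_list_def by (rule someI_ex)
  have "degree (\<Prod>e\<leftarrow>es. [:- e, 1:]) = length es" for es :: "complex list"
    by (rule degree_linear_factors)
  then show "length (eigval_list T) = N"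
    using * degree_monic_char_poly[OF T] by simp
  show "set (eigval_list T) = spectrum T"
    unfolding spectrum_root_char_poly[OF T] * by (auto simp: poly_prod_list o_def prod_list_zero_iff)
qed

(* conv {lambda_j : j in S}, with indices running over {..<N} *)
definition eigval_hull :: "complex mat \<Rightarrow> nat set \<Rightarrow> complex set" where
  "eigval_hull T S = convex hull ((\<lambda>j. eigval_list T ! j) ` S)"

definition higher_rank_numerical_range :: "nat \<Rightarrow> complex mat \<Rightarrow> complex set" where
  "higher_rank_numerical_range k T =
     {z. \<exists>P \<in> carrier_mat (dim_row T) (dim_row T).
           orthogonal_projection P \<and> vec_space.rank (dim_row T) P = k \<and>
           P * T * P = z \<cdot>\<^sub>m P}"

(* Used for 1 <= k <= dim_row T, where the subtraction on nat does not truncate. *)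
definition Omega :: "nat \<Rightarrow> complex mat \<Rightarrow> complex set" where
  "Omega k T =
     (\<Inter>S \<in> {S. S \<subseteq> {..<dim_row T} \<and> card S = dim_row T - k + 1}. eigval_hull T S)"

definition Delta :: "nat \<Rightarrow> complex mat \<Rightarrow> complex set" where
  "Delta k U =
     {z. \<exists>S :: nat \<Rightarrow> nat set.
           (\<forall>i<k. S i \<subseteq> {..<dim_row U}) \<and>
           disjoint_family_on S {..<k} \<and>
           (\<forall>i<k. z \<in> eigval_hull U (S i))}"

end

(* Half-plane depth: if z lies in the hull of every N - k + 1 of the eigenvalues, then every closed
   half-plane with z on its boundary contains at least k of them, since its complement would otherwise
   contain N - k + 1 eigenvalues whose hull misses z.

   Depth k at z and N >= 3k yield k disjoint hulls through z. Eigenvalues equal to z are split off as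
   singletons. If N > 3k and no point can be discarded without losing depth, then every point lies in
   a closed half-plane with exactly k points; by Caratheodory at most three such half-planes cover all
   points, so N <= 3k, a contradiction. If N = 3k, sort the points by their argument around z and
   take the triples with indices i, i + k, i + 2k: if an open half-plane contained
   such a triple, the opposite closed one would only contain points from one of the three blocks
   between cyclic neighbours of the triple, and each block has k - 1 points.

   Disjoint hulls give orthonormal vectors with coefficients the square roots of the convex weights in an
   eigenbasis; their span is the range of the required projection. Conversely a range of dimension k
   meets the span of any N - k + 1 eigenvectors, which exhibits z as a convex combination. *)
theory Submission
  imports Defs
begin

section \<open>Half-plane depth and disjoint convex hulls\<close>

text \<open>Tukey depth of the origin, stated for an indexed family so that coinciding points count
  separately. Since the half-planes are closed, a point at the origin counts in every
  direction.\<close>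

definition half_plane_depth_ge :: "('i \<Rightarrow> complex) \<Rightarrow> 'i set \<Rightarrow> nat \<Rightarrow> bool" where
  "half_plane_depth_ge p A k \<longleftrightarrow> (\<forall>u. u \<noteq> 0 \<longrightarrow> k \<le> card {j \<in> A. 0 \<le> inner u (p j)})"

section \<open>Separation in the plane and covers by closed half-planes\<close>

lemma zero_in_hull_or_separated:
  fixes V :: "complex set"
  assumes "finite V"
  obtains "0 \<in> convex hull V" | w where "w \<noteq> 0" "\<And>v. v \<in> V \<Longrightarrow> 0 < inner w v"
proof (cases "0 \<in> convex hull V")
  case False
  have "closed (convex hull V)"
    using assms by (simp add: compact_imp_closed finite_imp_compact_convex_hull)
  from separating_hyperplane_closed_0[OF convex_convex_hull this False]
  obtain a b where "a \<noteq> 0" "0 < b" "\<forall>x\<in>convex hull V. b < inner a x"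
    by blast
  then show ?thesis
    using that(2)[of a] hull_inc[of _ V convex] by (meson less_trans)
qed (use that in blast)

text \<open>The elements of \<open>V\<close> act as normals: if all had negative inner product with
  \<open>x\<close>, the hull would lie in an open half-plane that misses the origin. So the closed
  half-planes with these normals cover the plane.\<close>

lemma zero_in_hull_imp_nonneg:
  assumes "0 \<in> convex hull V"
  shows "\<exists>v\<in>V. 0 \<le> inner v (x :: complex)"
proof (rule ccontr)
  assume "\<not> ?thesis"
  then have "V \<subseteq> {v. inner x v < 0}"
    by (auto simp: inner_commute not_le)
  then have "convex hull V \<subseteq> {v. inner x v < 0}"
    by (rule hull_minimal) (rule convex_halfspace_lt)
  then show False using assms by auto
qed

text \<open>At most three of the closed half-planes with normals in \<open>V\<close> have the same
  union as all of them. If the origin is in the hull, a Caratheodory subset covers the whole plane;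
  otherwise the normals lie in an open half-plane and the two extreme directions suffice.\<close>

lemma half_plane_cover_three:
  fixes V :: "complex set"
  assumes fin: "finite V" and ne: "V \<noteq> {}"
  obtains T where "T \<subseteq> V" "card T \<le> 3"
    "\<And>v x. v \<in> V \<Longrightarrow> 0 \<le> inner v x \<Longrightarrow> \<exists>t\<in>T. 0 \<le> inner t x"
  using fin
proof (cases rule: zero_in_hull_or_separated)
  case 1
  then obtain T where T: "finite T" "T \<subseteq> V" "card T \<le> 3" "0 \<in> convex hull T"
    unfolding caratheodory[of V] by auto
  from T(2,3) zero_in_hull_imp_nonneg[OF T(4)] show ?thesis
    by (rule that)
next
  case (2 w)
  \<comment> \<open>\<open>s v\<close> is the slope of \<open>v\<close> in the orthogonal frame
    \<open>w\<close>, \<open>\<i> * w\<close>: up to a positive factor, \<open>v\<close> is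
    \<open>w + s v *\<^sub>R (\<i> * w)\<close>. Membership of \<open>x\<close> is then the sign of
    an affine function of the slope, which is largest at an extreme slope.\<close>
  define s where "s v = inner (\<i> * w) v / inner w v" for v
  have decomp: "inner v x * (norm w)\<^sup>2 = inner w v * (inner w x + s v * inner (\<i> * w) x)"
    if "v \<in> V" for v x
    using 2(2)[OF that] unfolding s_def cmod_power2
    by (simp add: field_simps) (simp add: inner_complex_def algebra_simps power2_eq_square)
  have sgn: "0 \<le> inner v x \<longleftrightarrow> 0 \<le> inner w x + s v * inner (\<i> * w) x" if "v \<in> V" for v x
  proof -
    have "0 \<le> inner v x \<longleftrightarrow> 0 \<le> inner v x * (norm w)\<^sup>2"
      using 2(1) by (simp add: zero_le_mult_iff)
    also have "\<dots> \<longleftrightarrow> 0 \<le> inner w x + s v * inner (\<i> * w) x"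
      unfolding decomp[OF that] using 2(2)[OF that] by (simp add: zero_le_mult_iff)
    finally show ?thesis .
  qed
  obtain a where a: "a \<in> V" "\<And>v. v \<in> V \<Longrightarrow> s a \<le> s v"
    using arg_min_if_finite[OF fin ne, of s] by (meson not_le)
  obtain b where b: "b \<in> V" "\<And>v. v \<in> V \<Longrightarrow> s v \<le> s b"
    using arg_min_if_finite[OF fin ne, of "\<lambda>v. - s v"] by (meson neg_less_iff_less not_le)
  show ?thesis
  proof (rule that[of "{a, b}"])
    fix v x assume v: "v \<in> V" "0 \<le> inner v x"
    show "\<exists>t\<in>{a, b}. 0 \<le> inner t x"
    proof (cases "0 \<le> inner (\<i> * w) x")
      case True
      then have "s v * inner (\<i> * w) x \<le> s b * inner (\<i> * w) x"
        using b(2)[OF v(1)] by (rule mult_right_mono[rotated])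
      then show ?thesis using v b(1) by (simp add: sgn)
    next
      case False
      then have "s v * inner (\<i> * w) x \<le> s a * inner (\<i> * w) x"
        using a(2)[OF v(1)] by (intro mult_right_mono_neg) auto
      then show ?thesis using v a(1) by (simp add: sgn)
    qed
  qed (use a b in \<open>auto simp: card_insert_if\<close>)
qed

text \<open>If every removal lost depth, each point would lie in a closed half-plane with only
  \<open>k\<close> points; at most three of these would cover \<open>A\<close>, leaving room for
  only \<open>3 * k\<close> points.\<close>

lemma half_plane_depth_ge_remove:
  assumes fin: "finite A" and depth: "half_plane_depth_ge p A k" and card: "3 * k < card A"
  shows "\<exists>j\<in>A. half_plane_depth_ge p (A - {j}) k"
proof (rule ccontr)
  define H where "H u = {i \<in> A. 0 \<le> inner u (p i)}" for u
  assume *: "\<not> ?thesis"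
  have "\<exists>u. u \<noteq> 0 \<and> card (H u - {j}) < k" if "j \<in> A" for j
  proof -
    have "{i \<in> A - {j}. 0 \<le> inner u (p i)} = H u - {j}" for u
      by (auto simp: H_def)
    then show ?thesis
      using * that unfolding half_plane_depth_ge_def by (metis not_le)
  qed
  then obtain u where u: "\<And>j. j \<in> A \<Longrightarrow> u j \<noteq> 0" "\<And>j. j \<in> A \<Longrightarrow> card (H (u j) - {j}) < k"
    by metis
  have finH: "finite (H v)" for v using fin by (simp add: H_def)
  \<comment> \<open>Depth puts at least \<open>k\<close> points into the half-plane, and fewer than
    \<open>k\<close> remain without \<open>j\<close>; so \<open>j\<close> is one of them and the
    count is exactly \<open>k\<close>.\<close>
  have tight: "j \<in> H (u j)" "card (H (u j)) \<le> k" if j: "j \<in> A" for j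
  proof -
    have "k \<le> card (H (u j))"
      using depth u(1)[OF j] by (simp add: half_plane_depth_ge_def H_def)
    with u(2)[OF j] show "j \<in> H (u j)" "card (H (u j)) \<le> k"
      using finH[of "u j"] by (cases "j \<in> H (u j)"; simp)+
  qed
  have "u ` A \<noteq> {}" using card by auto
  from half_plane_cover_three[OF finite_imageI[OF fin] this]
  obtain T where T: "T \<subseteq> u ` A" "card T \<le> 3"
    "\<And>v x. v \<in> u ` A \<Longrightarrow> 0 \<le> inner v x \<Longrightarrow> \<exists>t\<in>T. 0 \<le> inner t x"
    by blast
  have finT: "finite T" using T(1) fin finite_surj by blast
  have "A \<subseteq> (\<Union>t\<in>T. H t)"
  proof
    fix j assume j: "j \<in> A"
    then show "j \<in> (\<Union>t\<in>T. H t)"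
      using T(3)[of "u j" "p j"] tight(1)[OF j] by (auto simp: H_def)
  qed
  then have "card A \<le> card (\<Union>t\<in>T. H t)"
    using finT finH by (intro card_mono) auto
  also have "\<dots> \<le> (\<Sum>t\<in>T. card (H t))" using finT by (rule card_UN_le)
  also have "\<dots> \<le> card T * k"
    using sum_bounded_above[of T "\<lambda>t. card (H t)" k] T(1) tight(2) by auto
  also have "\<dots> \<le> 3 * k" using T(2) by simp
  finally show False using card by simp
qed

section \<open>Angular order around the origin\<close>

lemma cos_gt_zero_iff:
  assumes "\<bar>s\<bar> \<le> 2 * pi"
  shows "0 < cos s \<longleftrightarrow> \<bar>s\<bar> < pi / 2 \<or> 3 * pi / 2 < \<bar>s\<bar>"
proof -
  consider "\<bar>s\<bar> < pi / 2" | "pi / 2 \<le> \<bar>s\<bar>" "\<bar>s\<bar> \<le> 3 * pi / 2" | "3 * pi / 2 < \<bar>s\<bar>"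
    by linarith
  then have "0 < cos \<bar>s\<bar> \<longleftrightarrow> \<bar>s\<bar> < pi / 2 \<or> 3 * pi / 2 < \<bar>s\<bar>"
  proof cases
    case 1
    then show ?thesis using cos_gt_zero_pi[of "\<bar>s\<bar>"] pi_gt_zero by simp
  next
    case 2
    then have "0 \<le> cos (\<bar>s\<bar> - pi)" by (intro cos_ge_zero) auto
    then show ?thesis using 2 by (simp add: cos_diff)
  next
    case 3
    then have "0 < cos (2 * pi - \<bar>s\<bar>)" using assms by (intro cos_gt_zero_pi) auto
    then show ?thesis using 3 by (simp add: cos_diff)
  qed
  then show ?thesis by simp
qed

lemma inner_eq_cos_Arg: "inner w x = norm w * norm x * cos (Arg x - Arg w)"
proof -
  have *: "Re z = norm z * cos (Arg z)" "Im z = norm z * sin (Arg z)" for z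
    using rcis_cmod_Arg[of z] by (metis Re_rcis, metis Im_rcis)
  show ?thesis
    unfolding inner_complex_def *[of w] *[of x] cos_diff by (simp add: algebra_simps)
qed

text \<open>Principal arguments cut the circle at the negative real axis. An open half-plane and its
  closed complement give complementary arcs, one of which avoids the cut, so its arguments form an
  interval. The origin is excluded where its conventional argument 0 would break this.\<close>

lemma half_plane_Arg_convex:
  fixes w :: complex
  assumes "w \<noteq> 0"
  obtains
    "\<And>x y z. \<lbrakk>y \<noteq> 0; Arg x \<le> Arg y; Arg y \<le> Arg z; 0 < inner w x; 0 < inner w z\<rbrakk> \<Longrightarrow> 0 < inner w y"
  | "\<And>x y z. \<lbrakk>x \<noteq> 0; z \<noteq> 0; Arg x \<le> Arg y; Arg y \<le> Arg z; inner w x \<le> 0; inner w z \<le> 0\<rbrakk>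
        \<Longrightarrow> inner w y \<le> 0"
proof -
  have sgn: "0 < inner w x \<longleftrightarrow> x \<noteq> 0 \<and> (\<bar>Arg x - Arg w\<bar> < pi / 2 \<or> 3 * pi / 2 < \<bar>Arg x - Arg w\<bar>)" for x
  proof (cases "x = 0")
    case False
    have "\<bar>Arg x - Arg w\<bar> \<le> 2 * pi"
      using Arg_bounded[of x] Arg_bounded[of w] by linarith
    then show ?thesis
      using False assms cos_gt_zero_iff[of "Arg x - Arg w"]
      by (simp add: inner_eq_cos_Arg[of w x] zero_less_mult_iff del: times_divide_eq_left)
        (meson mult_nonneg_nonneg norm_ge_zero not_less)
  qed simp
  note bnd = Arg_bounded[of w]
  show ?thesis
  \<comment> \<open>The open half-plane avoids the negative real axis exactly when \<open>w\<close>
    has nonnegative real part.\<close>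
  proof (cases "\<bar>Arg w\<bar> \<le> pi / 2")
    case True
    show ?thesis
    proof (rule that(1))
      fix x y z
      assume "y \<noteq> 0" "Arg x \<le> Arg y" "Arg y \<le> Arg z" "0 < inner w x" "0 < inner w z"
      then show "0 < inner w y"
        using True Arg_bounded[of x] Arg_bounded[of z] sgn[of x] sgn[of y] sgn[of z] unfolding abs_if
        by (smt (verit) field_sum_of_halves)
    qed
  next
    case False
    show ?thesis
    proof (rule that(2))
      fix x y z
      assume "x \<noteq> 0" "z \<noteq> 0" "Arg x \<le> Arg y" "Arg y \<le> Arg z" "inner w x \<le> 0" "inner w z \<le> 0"
      then show "inner w y \<le> 0"
        using False bnd Arg_bounded[of x] Arg_bounded[of z] sgn[of x] sgn[of y] sgn[of z] unfolding abs_if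
        by (smt (verit) field_sum_of_halves)
    qed
  qed
qed

text \<open>Positions \<open>i\<close>, \<open>i + k\<close> and \<open>i + 2 * k\<close> cut the
  cyclic order into three gaps of \<open>k - 1\<close> positions. If some \<open>w\<close> were
  positive on the triple, the opposite closed half-plane would fit into one gap, against the
  depth.\<close>

lemma disjoint_hulls_card_eq:
  assumes fin: "finite A" and card: "card A = 3 * k" and depth: "half_plane_depth_ge p A k"
    and nz: "\<And>j. j \<in> A \<Longrightarrow> p j \<noteq> 0"
  shows "\<exists>S :: nat \<Rightarrow> 'i set. (\<forall>i<k. S i \<subseteq> A) \<and> disjoint_family_on S {..<k} \<and>
           (\<forall>i<k. 0 \<in> convex hull (p ` S i))"
proof -
  obtain xs where xs: "set xs = A" "distinct xs"
    using finite_distinct_list[OF fin] by blast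
  define e where "e = sort_key (\<lambda>j. Arg (p j)) xs"
  have e: "set e = A" "distinct e" "length e = 3 * k"
    using xs card distinct_card[of xs] by (auto simp: e_def)
  have sorted: "Arg (p (e ! m)) \<le> Arg (p (e ! n))" if "m \<le> n" "n < 3 * k" for m n
    using sorted_nth_mono[of "map (\<lambda>j. Arg (p j)) e" m n] that e(3) by (simp add: e_def)
  have nz': "p (e ! m) \<noteq> 0" if "m < 3 * k" for m
    using nz e that by (metis nth_mem)
  define S where "S i = {e ! i, e ! (i + k), e ! (i + 2 * k)}" for i
  have "0 \<in> convex hull (p ` S i)" if i: "i < k" for i
  proof -
    have "finite (p ` S i)" by (simp add: S_def)
    then show ?thesis
    proof (cases rule: zero_in_hull_or_separated)
      case (2 w)
      \<comment> \<open>Positions in the closed half-plane opposite to \<open>w\<close>; depth in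
        direction \<open>- w\<close> demands at least \<open>k\<close> of them.\<close>
      define J where "J = {m. m < 3 * k \<and> inner w (p (e ! m)) \<le> 0}"
      have S_pos: "0 < inner w (p (e ! i))" "0 < inner w (p (e ! (i + k)))"
          "0 < inner w (p (e ! (i + 2 * k)))"
        using 2(2) by (auto simp: S_def)
      then have notJ: "i \<notin> J" "i + k \<notin> J" "i + 2 * k \<notin> J" by (auto simp: J_def)
      have "{j \<in> A. 0 \<le> inner (- w) (p j)} = (!) e ` J"
        using e by (auto simp: J_def in_set_conv_nth image_iff)
      moreover have "k \<le> card {j \<in> A. 0 \<le> inner (- w) (p j)}"
        using depth 2(1) unfolding half_plane_depth_ge_def by (metis neg_equal_0_iff_equal)
      ultimately have "k \<le> card ((!) e ` J)" by simp
      also have "\<dots> \<le> card J" by (rule card_image_le) (simp add: J_def)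
      finally have cardJ: "k \<le> card J" .
      have small: False if "J \<subseteq> X" "card X < k" "finite X" for X
        using card_mono[OF that(3,1)] that(2) cardJ by linarith
      from 2(1) have False
      proof (cases rule: half_plane_Arg_convex)
        case 1
        \<comment> \<open>Everything from position \<open>i\<close> to \<open>i + 2 * k\<close> is
          in the open half-plane, so \<open>J\<close> sits in the gap that wraps around the end of
          the list: \<open>i\<close> positions in front and \<open>k - 1 - i\<close> behind.\<close>
        have "J \<subseteq> {..<i} \<union> {i + 2 * k<..<3 * k}"
        proof
          fix m assume m: "m \<in> J"
          show "m \<in> {..<i} \<union> {i + 2 * k<..<3 * k}"
          proof (rule ccontr)
            assume "\<not> ?thesis"
            then have "i \<le> m" "m \<le> i + 2 * k" using m by (auto simp: J_def)
            then have "0 < inner w (p (e ! m))"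
              using S_pos i m 1[OF nz' sorted[of i m] sorted[of m "i + 2 * k"]] by (auto simp: J_def)
            then show False using m by (simp add: J_def)
          qed
        qed
        moreover have "card ({..<i} \<union> {i + 2 * k<..<3 * k}) < k"
          using i by (intro le_less_trans[OF card_Un_le]) auto
        ultimately show False by (rule small) simp
      next
        case 2
        have conv: "l \<in> J" if "m \<in> J" "n \<in> J" "m \<le> l" "l \<le> n" for l m n
          using that 2[OF nz' nz' sorted[of m l] sorted[of l n]] by (auto simp: J_def)
        obtain m where m: "m \<in> J" using cardJ i by fastforce
        \<comment> \<open>\<open>J\<close> is now an interval of positions, so a position outside it
          has all of \<open>J\<close> on one side. The first and last of the four intervals below
          are the two pieces of the wrapping gap.\<close>
        have gap: "(n < l \<longleftrightarrow> m < l) \<and> n \<noteq> l" if "l \<notin> J" "n \<in> J" for l n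
          using that m conv[of m n l] conv[of n m l] by (metis linorder_not_less order.order_iff_strict)
        have "J \<subseteq> {..<i} \<or> J \<subseteq> {i<..<i+k} \<or> J \<subseteq> {i+k<..<i+2*k} \<or> J \<subseteq> {i+2*k<..<3*k}"
          using gap[OF notJ(1)] gap[OF notJ(2)] gap[OF notJ(3)]
          unfolding subset_eq lessThan_iff greaterThanLessThan_iff
          by (smt (verit) J_def linorder_neqE_nat mem_Collect_eq)
        moreover have "card {..<i} < k" "card {i<..<i+k} < k" "card {i+k<..<i+2*k} < k"
          "card {i+2*k<..<3*k} < k"
          using i by auto
        ultimately show False using small by (meson finite_lessThan finite_greaterThanLessThan)
      qed
      then show ?thesis ..
    qed
  qed
  moreover have "S i \<subseteq> A" if "i < k" for i
    using that e by (auto simp: S_def)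
  moreover have "disjoint_family_on S {..<k}"
    using e(2,3) by (auto simp: disjoint_family_on_def S_def nth_eq_iff_index_eq)
  ultimately show ?thesis by blast
qed

text \<open>Surplus points are discarded one at a time, keeping depth \<open>k\<close>, until
  exactly \<open>3 * k\<close> are left.\<close>

lemma disjoint_hulls_nonzero:
  assumes "finite A" "3 * k \<le> card A" "half_plane_depth_ge p A k" "\<And>j. j \<in> A \<Longrightarrow> p j \<noteq> 0"
  shows "\<exists>S :: nat \<Rightarrow> 'i set. (\<forall>i<k. S i \<subseteq> A) \<and> disjoint_family_on S {..<k} \<and>
           (\<forall>i<k. 0 \<in> convex hull (p ` S i))"
  using assms
proof (induction "card A" arbitrary: A)
  case 0
  then show ?case using disjoint_hulls_card_eq[of A k p] by simp
next
  case (Suc n)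
  show ?case
  proof (cases "card A = 3 * k")
    case True
    with Suc.prems show ?thesis using disjoint_hulls_card_eq[of A k p] by blast
  next
    case False
    with Suc.prems obtain j where j: "j \<in> A" "half_plane_depth_ge p (A - {j}) k"
      using half_plane_depth_ge_remove[of A p k] by force
    have "\<exists>S :: nat \<Rightarrow> 'i set. (\<forall>i<k. S i \<subseteq> A - {j}) \<and> disjoint_family_on S {..<k} \<and>
           (\<forall>i<k. 0 \<in> convex hull (p ` S i))"
      using Suc.prems Suc.hyps(2) False j by (intro Suc.hyps(1)) auto
    then show ?thesis by blast
  qed
qed

text \<open>A point at the origin has no direction, but its singleton hull already contains the
  origin. Splitting it off lowers \<open>k\<close> and every half-plane count by one, and the family
  loses one point where it could afford three.\<close>

lemma disjoint_hulls:
  assumes "finite A" "3 * k \<le> card A" "half_plane_depth_ge p A k"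
  shows "\<exists>S :: nat \<Rightarrow> 'i set. (\<forall>i<k. S i \<subseteq> A) \<and> disjoint_family_on S {..<k} \<and>
           (\<forall>i<k. 0 \<in> convex hull (p ` S i))"
  using assms
proof (induction k arbitrary: A)
  case 0
  then show ?case by (simp add: disjoint_family_on_def)
next
  case (Suc k)
  show ?case
  proof (cases "\<exists>j\<in>A. p j = 0")
    case False
    with Suc.prems show ?thesis by (intro disjoint_hulls_nonzero) auto
  next
    case True
    then obtain j where j: "j \<in> A" "p j = 0" by blast
    have "k \<le> card {i \<in> A - {j}. 0 \<le> inner u (p i)}" if "u \<noteq> 0" for u
    proof -
      have "{i \<in> A - {j}. 0 \<le> inner u (p i)} = {i \<in> A. 0 \<le> inner u (p i)} - {j}" by auto
      moreover have "Suc k \<le> card {i \<in> A. 0 \<le> inner u (p i)}"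
        using Suc.prems(3) that by (simp add: half_plane_depth_ge_def)
      ultimately show ?thesis using Suc.prems(1) j by (simp add: card_Diff_singleton)
    qed
    then have "half_plane_depth_ge p (A - {j}) k" by (simp add: half_plane_depth_ge_def)
    moreover have "3 * k \<le> card (A - {j})"
      using Suc.prems(1,2) j(1) by (simp add: card_Diff_singleton)
    ultimately obtain S where S: "\<forall>i<k. S i \<subseteq> A - {j}" "disjoint_family_on S {..<k}"
      "\<forall>i<k. 0 \<in> convex hull (p ` S i)"
      using Suc.IH[of "A - {j}"] Suc.prems(1) by blast
    show ?thesis
    proof (intro exI[of _ "S(k := {j})"] conjI)
      show "disjoint_family_on (S(k := {j})) {..<Suc k}"
        using S(1) disjoint_family_onD[OF S(2)]
        by (fastforce simp: disjoint_family_on_def less_Suc_eq)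
    qed (use S j in \<open>auto simp: less_Suc_eq\<close>)
  qed
qed

text \<open>A half-plane with fewer than \<open>k\<close> points leaves at least
  \<open>card A - k + 1\<close> outside, and their hull stays strictly on the other side of the line
  through \<open>z\<close>.\<close>

lemma half_plane_depth_geI:
  assumes fin: "finite A" and "k \<le> card A"
    and hull: "\<And>S. S \<subseteq> A \<Longrightarrow> card S = card A - k + 1 \<Longrightarrow> z \<in> convex hull (f ` S)"
  shows "half_plane_depth_ge (\<lambda>j. f j - z) A k"
  unfolding half_plane_depth_ge_def
proof (intro allI impI, rule ccontr)
  fix u :: complex
  define H where "H = {j \<in> A. 0 \<le> inner u (f j - z)}"
  assume "\<not> k \<le> card {j \<in> A. 0 \<le> inner u (f j - z)}"
  then have "card H < k" by (simp add: H_def)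
  then have "card A - k + 1 \<le> card (A - H)"
    using assms(2) fin by (subst card_Diff_subset) (auto simp: H_def)
  then obtain S where S: "S \<subseteq> A - H" "card S = card A - k + 1"
    by (meson obtain_subset_with_card_n)
  then have "z \<in> convex hull (f ` S)" by (intro hull) auto
  moreover have "convex hull (f ` S) \<subseteq> {x. inner u x < inner u z}"
    using S(1) by (intro hull_minimal convex_halfspace_lt) (auto simp: H_def inner_diff_right)
  ultimately show False by auto
qed

section \<open>Matrices\<close>

lemma mat_adjoint_carrier [simp]:
  "A \<in> carrier_mat m n \<Longrightarrow> mat_adjoint A \<in> carrier_mat n m"
  unfolding mat_adjoint_def by (auto simp: mat_of_rows_def)

lemma mat_adjoint_index:
  fixes A :: "complex mat"
  assumes "A \<in> carrier_mat m n" "i < n" "j < m"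
  shows "mat_adjoint A $$ (i, j) = cnj (A $$ (j, i))"
  using assms unfolding mat_adjoint_def by (auto simp: mat_of_rows_index)

lemma mat_adjoint_adjoint:
  fixes A :: "complex mat"
  assumes "A \<in> carrier_mat m n"
  shows "mat_adjoint (mat_adjoint A) = A"
  using assms
  by (intro eq_matI)
    (auto simp: mat_adjoint_index[OF mat_adjoint_carrier[OF assms]] mat_adjoint_index[OF assms]
       dest: mat_adjoint_carrier)

lemma mat_mult_index:
  assumes "A \<in> carrier_mat m n" "B \<in> carrier_mat n l" "i < m" "j < l"
  shows "(A * B) $$ (i, j) = (\<Sum>a<n. A $$ (i, a) * B $$ (a, j))"
  using assms by (auto simp: scalar_prod_def atLeast0LessThan)

lemma mat_adjoint_mult:
  fixes A :: "complex mat"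
  assumes A: "A \<in> carrier_mat m n" and B: "B \<in> carrier_mat n l"
  shows "mat_adjoint (A * B) = mat_adjoint B * mat_adjoint A"
proof (rule eq_matI)
  have AB: "A * B \<in> carrier_mat m l" using A B by simp
  note A' = mat_adjoint_carrier[OF A] and B' = mat_adjoint_carrier[OF B]
  fix i j assume "i < dim_row (mat_adjoint B * mat_adjoint A)"
    "j < dim_col (mat_adjoint B * mat_adjoint A)"
  then have ij: "i < l" "j < m" using A' B' by auto
  show "mat_adjoint (A * B) $$ (i, j) = (mat_adjoint B * mat_adjoint A) $$ (i, j)"
    unfolding mat_adjoint_index[OF AB ij] mat_mult_index[OF A B ij(2,1)] mat_mult_index[OF B' A' ij]
    using ij by (auto intro!: sum.cong simp: mat_adjoint_index[OF A] mat_adjoint_index[OF B])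
qed (use mat_adjoint_carrier[OF A] mat_adjoint_carrier[OF B] mat_adjoint_carrier[OF mult_carrier_mat[OF A B]] in auto)

text \<open>Zero rows are appended to make \<open>C\<close> square and singular. The kernel vector
  is a one-column matrix so that associativity of matrix products applies to it.\<close>

lemma wide_mat_kernel:
  fixes C :: "'a :: field mat"
  assumes C: "C \<in> carrier_mat m r" and "m < r"
  obtains Y where "Y \<in> carrier_mat r 1" "Y \<noteq> 0\<^sub>m r 1" "C * Y = 0\<^sub>m m 1"
proof -
  define c where "c i = (if i < m then row C i else 0\<^sub>v r)" for i
  \<comment> \<open>\<open>c\<close> already vanishes from row \<open>m\<close> on; the explicit
    case at \<open>m\<close> matches the shape of \<open>det_row_0\<close>.\<close>
  define D where "D = mat\<^sub>r r r (\<lambda>i. if i = m then 0\<^sub>v r else c i)"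
  have D: "D \<in> carrier_mat r r" by (simp add: D_def)
  have "det D = 0"
    unfolding D_def using assms by (intro det_row_0) (auto simp: c_def)
  then obtain y where y: "y \<in> carrier_vec r" "y \<noteq> 0\<^sub>v r" "D *\<^sub>v y = 0\<^sub>v r"
    using det_0_iff_vec_prod_zero_field[OF D] by blast
  define Y where "Y = mat_of_cols r [y]"
  have Y: "Y \<in> carrier_mat r 1" by (simp add: Y_def mat_of_cols_def)
  have colY: "col Y 0 = y" using y(1) by (simp add: Y_def)
  have "Y \<noteq> 0\<^sub>m r 1" using colY y(2) by auto
  moreover have "C * Y = 0\<^sub>m m 1"
  proof (rule eq_matI)
    fix i j assume "i < dim_row (0\<^sub>m m 1 :: 'a mat)" "j < dim_col (0\<^sub>m m 1 :: 'a mat)"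
    then have ij: "i < m" "j = 0" by auto
    have "row D i = row C i" using ij assms by (auto simp: D_def c_def)
    then have "(C * Y) $$ (i, j) = (D *\<^sub>v y) $ i"
      using ij C Y colY D assms by simp
    also have "\<dots> = 0" using y(3) ij assms by simp
    finally show "(C * Y) $$ (i, j) = 0\<^sub>m m 1 $$ (i, j)" using ij by simp
  qed (use C Y in auto)
  ultimately show ?thesis using Y that by blast
qed

text \<open>\<open>B\<close> consists of a maximal independent set of columns of \<open>A\<close>,
  and \<open>M\<close> holds the coordinates of all columns in it. This turns statements about rank
  into matrix equations; the last clause is the independence of the columns of
  \<open>B\<close>.\<close>

lemma (in vec_space) rank_factorization:
  assumes A: "A \<in> carrier_mat n nc"
  obtains B M where "B \<in> carrier_mat n (rank A)" "M \<in> carrier_mat (rank A) nc" "A = B * M"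
    "set (cols B) \<subseteq> set (cols A)"
    "\<And>Y. Y \<in> carrier_mat (rank A) 1 \<Longrightarrow> B * Y = 0\<^sub>m n 1 \<Longrightarrow> Y = 0\<^sub>m (rank A) 1"
proof -
  let ?P = "\<lambda>T. T \<subseteq> set (cols A) \<and> lin_indpt T"
  have colsA: "set (cols A) \<subseteq> carrier_vec n" using A cols_dim by blast
  have "lin_indpt {}" by (auto simp: lin_dep_def)
  then obtain S where S: "finite S" "maximal S ?P"
    using maximal_exists_superset[of "set (cols A)" ?P "{}"] by auto
  then have S': "S \<subseteq> set (cols A)" "lin_indpt S" by (auto simp: maximal_def)
  have SC: "S \<subseteq> carrier_vec n" using S' colsA by blast
  obtain xs where xs: "set xs = S" "distinct xs" using finite_distinct_list[OF S(1)] by blast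
  have r: "rank A = length xs"
    using rank_card_indpt[OF A S(2)] xs distinct_card by metis
  define B where "B = mat_of_cols n xs"
  have B: "B \<in> carrier_mat n (rank A)" by (simp add: B_def r mat_of_cols_def)
  have colsB: "cols B = xs" using SC xs(1) by (simp add: B_def)
  have dB: "distinct (cols B)" by (simp add: colsB xs)
  \<comment> \<open>By maximality: adjoining a column outside the span would give a larger
    independent set.\<close>
  have in_span: "v \<in> span S" if v: "v \<in> set (cols A)" for v
  proof (rule ccontr)
    assume "v \<notin> span S"
    then have "v \<notin> S" using span_mem[OF SC] by blast
    then have "lin_indpt (S \<union> {v})"
      using lin_dep_iff_in_span[of S v] \<open>v \<notin> span S\<close> SC S'(2) v colsA by auto
    then have "?P (S \<union> {v})" using S'(1) v by auto
    with S(2) \<open>v \<notin> S\<close> show False unfolding maximal_def by blast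
  qed
  have "\<exists>m \<in> carrier_vec (rank A). col A j = B *\<^sub>v m" if j: "j < nc" for j
  proof -
    have "col A j \<in> span S" using j A by (intro in_span) (auto simp: cols_def)
    then obtain a where a: "col A j = lincomb a S"
      using finite_span[OF S(1) SC] by auto
    show ?thesis
      using mat_mult_eq_lincomb[OF B dB, of a] a
      by (intro bexI[of _ "Matrix.vec (rank A) (\<lambda>i. a (col B i))"]) (auto simp: colsB xs)
  qed
  then obtain f where f: "\<And>j. j < nc \<Longrightarrow> f j \<in> carrier_vec (rank A)"
    "\<And>j. j < nc \<Longrightarrow> col A j = B *\<^sub>v f j" by metis
  define M where "M = mat_of_cols (rank A) (map f [0..<nc])"
  have M: "M \<in> carrier_mat (rank A) nc" by (simp add: M_def mat_of_cols_def)
  have colM: "col M j = f j" if "j < nc" for j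
    using that f(1) by (simp add: M_def)
  have "A = B * M"
  proof (rule mat_col_eqI)
    fix j assume j: "j < dim_col (B * M)"
    then have "col (B * M) j = B *\<^sub>v col M j"
      using M B by (intro col_mult2) auto
    then show "col A j = col (B * M) j" using j M f(2) colM by simp
  qed (use A B M in auto)
  moreover have "Y = 0\<^sub>m (rank A) 1" if Y: "Y \<in> carrier_mat (rank A) 1" "B * Y = 0\<^sub>m n 1" for Y
  proof -
    have y: "col Y 0 \<in> carrier_vec (rank A)" by (rule col_dim[of Y 0, unfolded carrier_matD(1)[OF Y(1)]])
    have "B *\<^sub>v col Y 0 = col (B * Y) 0" using col_mult2[OF B Y(1)] by simp
    also have "\<dots> = 0\<^sub>v n" unfolding Y(2) by simp
    finally have By: "B *\<^sub>v col Y 0 = 0\<^sub>v n" .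
    have "col Y 0 = 0\<^sub>v (rank A)"
    proof (rule ccontr)
      assume "col Y 0 \<noteq> 0\<^sub>v (rank A)"
      from lin_depI[OF B y this By dB] show False using S'(2) unfolding colsB xs(1) by blast
    qed
    then have "col Y j = col (0\<^sub>m (rank A) 1) j" if "j < 1" for j using that by simp
    then show ?thesis using Y(1) by (intro mat_col_eqI) auto
  qed
  ultimately show ?thesis using that[OF B M] S'(1) by (simp add: colsB xs)
qed

text \<open>An idempotent fixes its own columns, hence every matrix assembled from them.\<close>

lemma idempotent_mult_cols:
  fixes P :: "'a :: comm_ring_1 mat"
  assumes P: "P \<in> carrier_mat n n" "P * P = P" and B: "B \<in> carrier_mat n r"
    and cols: "set (cols B) \<subseteq> set (cols P)"
  shows "P * B = B"
proof (rule mat_col_eqI)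
  fix j assume "j < dim_col B"
  then have j: "j < r" using B by simp
  then have "col B j \<in> set (cols B)" using B by (auto simp: cols_def)
  then obtain i where i: "i < n" "col B j = col P i"
    using cols P(1) by (auto simp: cols_def)
  have "col (P * B) j = P *\<^sub>v col P i" using col_mult2[OF P(1) B j] i by simp
  also have "\<dots> = col (P * P) i" using col_mult2[OF P(1) P(1) i(1)] by simp
  finally show "col (P * B) j = col B j" using P(2) i by simp
qed (use P B in auto)

text \<open>For the rank, compare with a full-rank factorization \<open>?P = C * M\<close>. Both
  \<open>B\<close> and \<open>C\<close> have trivial kernel and are fixed by \<open>?P\<close>, so
  neither \<open>mat_adjoint B * C\<close> nor \<open>M * B\<close> can have a kernel; this excludes
  a rank above or below \<open>k\<close>.\<close>

lemma isometry_range_projection: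
  fixes B :: "complex mat"
  assumes B: "B \<in> carrier_mat n k" and iso: "mat_adjoint B * B = 1\<^sub>m k"
  shows "orthogonal_projection (B * mat_adjoint B)" "vec_space.rank n (B * mat_adjoint B) = k"
proof -
  interpret vec_space "TYPE(complex)" n .
  let ?P = "B * mat_adjoint B"
  note B' = mat_adjoint_carrier[OF B]
  have P: "?P \<in> carrier_mat n n" using B B' by simp
  have PB: "?P * B = B" using assoc_mult_mat[OF B B' B] iso B by simp
  have PP: "?P * ?P = ?P" using assoc_mult_mat[OF P B B'] PB by simp
  show "orthogonal_projection ?P"
    unfolding orthogonal_projection_def
    using carrier_matD[OF B] carrier_matD[OF B'] PP mat_adjoint_mult[OF B B'] mat_adjoint_adjoint[OF B] by auto
  obtain C M where CM: "C \<in> carrier_mat n (rank ?P)" "M \<in> carrier_mat (rank ?P) n" "?P = C * M"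
    "set (cols C) \<subseteq> set (cols ?P)"
    "\<And>Y. Y \<in> carrier_mat (rank ?P) 1 \<Longrightarrow> C * Y = 0\<^sub>m n 1 \<Longrightarrow> Y = 0\<^sub>m (rank ?P) 1"
    using rank_factorization[OF P] by metis
  have PC: "?P * C = C" by (rule idempotent_mult_cols[OF P PP CM(1,4)])
  have "\<not> k < rank ?P"
  proof
    assume "k < rank ?P"
    then obtain Y where Y: "Y \<in> carrier_mat (rank ?P) 1" "Y \<noteq> 0\<^sub>m (rank ?P) 1"
      "(mat_adjoint B * C) * Y = 0\<^sub>m k 1"
      using wide_mat_kernel[OF mult_carrier_mat[OF B' CM(1)]] by blast
    have CY: "C * Y \<in> carrier_mat n 1" using CM(1) Y(1) by simp
    have "C * Y = ?P * (C * Y)" using PC assoc_mult_mat[OF P CM(1) Y(1)] by simp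
    also have "\<dots> = B * (mat_adjoint B * (C * Y))" by (rule assoc_mult_mat[OF B B' CY])
    also have "\<dots> = 0\<^sub>m n 1" unfolding assoc_mult_mat[OF B' CM(1) Y(1), symmetric] Y(3) using B by simp
    finally show False using CM(5) Y by blast
  qed
  moreover have "\<not> rank ?P < k"
  proof
    assume "rank ?P < k"
    then obtain Y where Y: "Y \<in> carrier_mat k 1" "Y \<noteq> 0\<^sub>m k 1" "(M * B) * Y = 0\<^sub>m (rank ?P) 1"
      using wide_mat_kernel[OF mult_carrier_mat[OF CM(2) B]] by blast
    have BY: "B * Y \<in> carrier_mat n 1" using B Y(1) by simp
    have "B * Y = ?P * (B * Y)" using PB assoc_mult_mat[OF P B Y(1)] by simp
    also have "\<dots> = C * (M * (B * Y))" unfolding CM(3) by (rule assoc_mult_mat[OF CM(1,2) BY])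
    also have "\<dots> = 0\<^sub>m n 1" unfolding assoc_mult_mat[OF CM(2) B Y(1), symmetric] Y(3) using CM(1) by simp
    finally have "B * Y = 0\<^sub>m n 1" .
    then have "mat_adjoint B * (B * Y) = 0\<^sub>m k 1" using B' by simp
    then show False using assoc_mult_mat[OF B' B Y(1)] iso Y(1,2) by simp
  qed
  ultimately show "rank ?P = k" by simp
qed

text \<open>One eigenvector per eigenvalue gives \<open>W\<close>. Unitarity leaves its Gram matrix
  \<open>G\<close> unchanged when entry \<open>(i, j)\<close> is multiplied by
  \<open>cnj (lam i) * lam j\<close>, so distinct eigenvalues make \<open>G\<close> diagonal, and
  rescaling the columns gives \<open>V\<close>.\<close>

lemma unitary_diagonalization:
  assumes U: "U \<in> carrier_mat N N" and unitary: "unitary_mat U" and card: "card (spectrum U) = N"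
  obtains V where "V \<in> carrier_mat N N" "mat_adjoint V * V = 1\<^sub>m N" "V * mat_adjoint V = 1\<^sub>m N"
    "U * V = V * mat_diag N (\<lambda>j. eigval_list U ! j)"
proof -
  define lam where "lam j = eigval_list U ! j" for j
  let ?D = "mat_diag N lam"
  have D: "?D \<in> carrier_mat N N" by simp
  have len: "length (eigval_list U) = N" by (rule length_eigval_list[OF U])
  have dist: "distinct (eigval_list U)"
    using card len set_eigval_list[OF U] by (intro card_distinct) simp
  have "\<exists>v. eigenvector U v (lam j)" if "j < N" for j
  proof -
    have "lam j \<in> spectrum U"
      using that len set_eigval_list[OF U] by (metis lam_def nth_mem)
    then show ?thesis by (auto simp: spectrum_def eigenvalue_def)
  qed
  then obtain v where v: "\<And>j. j < N \<Longrightarrow> eigenvector U (v j) (lam j)" by metis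
  have v': "v j \<in> carrier_vec N" "v j \<noteq> 0\<^sub>v N" "U *\<^sub>v v j = lam j \<cdot>\<^sub>v v j" if "j < N" for j
    using v[OF that] U by (auto simp: eigenvector_def)
  define W where "W = mat_of_cols N (map v [0..<N])"
  have W: "W \<in> carrier_mat N N" by (simp add: W_def mat_of_cols_def)
  have colW: "col W j = v j" if "j < N" for j
    using that v' by (simp add: W_def)
  have UW: "U * W = W * ?D"
  proof (rule eq_matI)
    fix i j assume "i < dim_row (W * ?D)" "j < dim_col (W * ?D)"
    then have ij: "i < N" "j < N" using W carrier_matD[OF D] by auto
    have "(U * W) $$ (i, j) = (U *\<^sub>v v j) $ i" using ij U W colW by simp
    also have "\<dots> = lam j * col W j $ i" using ij v'(3)[OF ij(2)] carrier_vecD[OF v'(1)[OF ij(2)]] colW by simp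
    also have "\<dots> = (W * ?D) $$ (i, j)"
      using ij W by (simp add: mat_diag_mult_right[OF W])
    finally show "(U * W) $$ (i, j) = (W * ?D) $$ (i, j)" .
  qed (use carrier_matD[OF U] carrier_matD[OF W] carrier_matD[OF D] in auto)
  define G where "G = mat_adjoint W * W"
  note W' = mat_adjoint_carrier[OF W] and U' = mat_adjoint_carrier[OF U] and D' = mat_adjoint_carrier[OF D]
  have UW_c: "U * W \<in> carrier_mat N N" and WD_c: "W * ?D \<in> carrier_mat N N" using U W by auto
  have G: "G \<in> carrier_mat N N" unfolding G_def by (rule mult_carrier_mat[OF W' W])
  have UU: "mat_adjoint U * U = 1\<^sub>m N" using unitary U by (auto simp: unitary_mat_def)
  have "mat_adjoint (U * W) * (U * W) = mat_adjoint W * (mat_adjoint U * (U * W))"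
    using assoc_mult_mat[OF W' U' UW_c] by (simp add: mat_adjoint_mult[OF U W])
  also have "\<dots> = G" using assoc_mult_mat[OF U' U W] UU W by (simp add: G_def)
  finally have "G = mat_adjoint (W * ?D) * (W * ?D)" by (simp add: UW)
  also have "\<dots> = mat_adjoint ?D * (mat_adjoint W * (W * ?D))"
    using assoc_mult_mat[OF D' W' WD_c] by (simp add: mat_adjoint_mult[OF W D])
  also have "\<dots> = mat_adjoint ?D * (G * ?D)"
    using assoc_mult_mat[OF W' W D] by (simp add: G_def)
  finally have GD: "G = mat_adjoint ?D * (G * ?D)" .
  have adjD: "mat_adjoint ?D = mat_diag N (\<lambda>j. cnj (lam j))"
    using carrier_matD[OF D'] mat_adjoint_index[OF D]
    by (intro eq_matI) (simp_all add: mat_diag_def)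
  have G_scale: "G $$ (i, j) = cnj (lam i) * G $$ (i, j) * lam j" if "i < N" "j < N" for i j
    using arg_cong[OF GD, of "\<lambda>X. X $$ (i, j)"] that G
    by (simp add: adjD mat_diag_mult_left[of _ N N] mat_diag_mult_right[OF G] del: mat_diag_dim)
  define s where "s j = (\<Sum>m<N. (cmod (W $$ (m, j)))\<^sup>2)" for j
  have G_index: "G $$ (i, j) = (\<Sum>m<N. cnj (W $$ (m, i)) * W $$ (m, j))" if "i < N" "j < N" for i j
    unfolding G_def mat_mult_index[OF W' W that] using that by (simp add: mat_adjoint_index[OF W])
  have G_diag: "G $$ (j, j) = of_real (s j)" if "j < N" for j
    unfolding G_index[OF that that] s_def by (simp add: complex_norm_square mult.commute del: of_real_power)
  have s_pos: "0 < s j" if j: "j < N" for j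
  proof -
    obtain m where "m < N" "v j $ m \<noteq> 0"
      using v'(1,2)[OF j] by (metis carrier_vecD eq_vecI index_zero_vec)
    then have "0 < (cmod (W $$ (m, j)))\<^sup>2" using colW[OF j] W j by (auto simp flip: index_col)
    then show ?thesis unfolding s_def using \<open>m < N\<close> by (intro sum_pos2[of _ m]) auto
  qed
  \<comment> \<open>Diagonal entries of \<open>G\<close> are positive, so the eigenvalues have
    modulus one; conjugation then inverts them, which the off-diagonal case uses.\<close>
  have lam1: "cnj (lam j) * lam j = 1" if "j < N" for j
    using G_scale[OF that that] s_pos[OF that] unfolding G_diag[OF that] by simp
  have G_off: "G $$ (i, j) = 0" if "i < N" "j < N" "i \<noteq> j" for i j
  proof (rule ccontr)
    assume "G $$ (i, j) \<noteq> 0"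
    then have "cnj (lam i) * lam j = 1" using G_scale[OF that(1,2)] by simp
    then have "lam i = lam j" using lam1[OF that(1)] by (metis mult_cancel_left mult_zero_left zero_neq_one)
    then show False using dist that len by (simp add: lam_def nth_eq_iff_index_eq)
  qed
  \<comment> \<open>\<open>s j\<close> is the squared norm of column \<open>j\<close> of
    \<open>W\<close>, so \<open>E\<close> normalises the columns.\<close>
  define E where "E = mat_diag N (\<lambda>j. of_real (1 / sqrt (s j)) :: complex)"
  have E: "E \<in> carrier_mat N N" by (simp add: E_def)
  note E' = mat_adjoint_carrier[OF E]
  have adjE: "mat_adjoint E = E"
    using carrier_matD[OF E'] carrier_matD[OF E] mat_adjoint_index[OF E]
    by (intro eq_matI) (simp_all add: E_def mat_diag_def)
  define V where "V = W * E"
  have V: "V \<in> carrier_mat N N" using W E by (simp add: V_def)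
  note V' = mat_adjoint_carrier[OF V]
  have "mat_adjoint V * V = E * (G * E)"
    unfolding V_def mat_adjoint_mult[OF W E] adjE G_def
    using assoc_mult_mat[OF E W' mult_carrier_mat[OF W E]] assoc_mult_mat[OF W' W E] by simp
  also have "\<dots> = 1\<^sub>m N"
  proof (rule eq_matI)
    fix i j assume "i < dim_row (1\<^sub>m N :: complex mat)" "j < dim_col (1\<^sub>m N :: complex mat)"
    then have ij: "i < N" "j < N" by auto
    have "(E * (G * E)) $$ (i, j) = of_real (1 / sqrt (s i)) * G $$ (i, j) * of_real (1 / sqrt (s j))"
      using ij G E by (simp add: E_def mat_diag_mult_left[of _ N N] mat_diag_mult_right[OF G] del: mat_diag_dim)
    also have "\<dots> = 1\<^sub>m N $$ (i, j)"
    proof (cases "i = j")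
      case True
      have "of_real (1 / sqrt (s j)) * of_real (s j) * of_real (1 / sqrt (s j)) = (of_real 1 :: complex)"
        unfolding of_real_mult[symmetric] using s_pos[OF ij(2)]
        by (subst of_real_eq_iff) (simp add: field_simps)
      then show ?thesis using True ij G_diag by simp
    next
      case False
      then show ?thesis using ij G_off by simp
    qed
    finally show "(E * (G * E)) $$ (i, j) = 1\<^sub>m N $$ (i, j)" .
  qed (use E G in auto)
  finally have VV: "mat_adjoint V * V = 1\<^sub>m N" .
  have DE: "?D * E = E * ?D"
    unfolding E_def by (simp add: mult.commute)
  have "U * V = U * W * E" unfolding V_def using assoc_mult_mat[OF U W E] by simp
  also have "\<dots> = W * (?D * E)" unfolding UW by (rule assoc_mult_mat[OF W D E])
  also have "\<dots> = V * ?D" unfolding DE V_def using assoc_mult_mat[OF W E D] by simp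
  finally have "U * V = V * mat_diag N (\<lambda>j. eigval_list U ! j)" by (simp add: lam_def[abs_def])
  then show ?thesis
    using that V VV mat_mult_left_right_inverse[OF V' V VV] by blast
qed

section \<open>Higher-rank numerical ranges\<close>

text \<open>Hull weights belong to points; injectivity moves them to indices, and extension by zero
  lets all sums run over the whole index range.\<close>

lemma convex_hull_image_coeffs:
  fixes f :: "nat \<Rightarrow> complex"
  assumes inj: "inj_on f {..<N}" and S: "S \<subseteq> {..<N}" and z: "z \<in> convex hull (f ` S)"
  obtains c :: "nat \<Rightarrow> real" where "\<And>j. 0 \<le> c j" "\<And>j. j \<notin> S \<Longrightarrow> c j = 0"
    "(\<Sum>j<N. c j) = 1" "(\<Sum>j<N. of_real (c j) * f j) = z"
proof -
  have finS: "finite S" using S finite_subset by blast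
  obtain u where u: "\<forall>x\<in>f ` S. 0 \<le> u x" "sum u (f ` S) = 1" "(\<Sum>x\<in>f ` S. u x *\<^sub>R x) = z"
    using z unfolding convex_hull_finite[OF finite_imageI[OF finS]] by blast
  have injS: "inj_on f S" using inj S by (rule inj_on_subset)
  define c where "c j = (if j \<in> S then u (f j) else 0)" for j
  have "(\<Sum>j<N. c j) = (\<Sum>j\<in>S. u (f j))"
    using S by (intro sum.mono_neutral_cong_right) (auto simp: c_def)
  moreover have "(\<Sum>j<N. of_real (c j) * f j) = (\<Sum>j\<in>S. u (f j) *\<^sub>R f j)"
    using S by (intro sum.mono_neutral_cong_right) (auto simp: c_def scaleR_conv_of_real)
  ultimately show ?thesis
    using u injS by (intro that[of c]) (auto simp: c_def sum.reindex)
qed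

text \<open>The compression of \<open>U\<close> to the span of the constructed vectors is
  \<open>z\<close> times the identity. \<open>C\<close> holds these vectors in eigenbasis
  coordinates, \<open>B\<close> in the original ones.\<close>

lemma Delta_subset_higher_rank_numerical_range:
  assumes U: "U \<in> carrier_mat N N" and unitary: "unitary_mat U" and card: "card (spectrum U) = N"
  shows "Delta k U \<subseteq> higher_rank_numerical_range k U"
proof
  define lam where "lam j = eigval_list U ! j" for j
  let ?D = "mat_diag N lam"
  have D: "?D \<in> carrier_mat N N" by simp
  obtain V where V: "V \<in> carrier_mat N N" and VV: "mat_adjoint V * V = 1\<^sub>m N"
    and UV: "U * V = V * ?D"
    using unitary_diagonalization[OF U unitary card] by (auto simp: lam_def[abs_def])
  note V' = mat_adjoint_carrier[OF V]
  have len: "length (eigval_list U) = N" by (rule length_eigval_list[OF U])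
  have "distinct (eigval_list U)"
    using card len set_eigval_list[OF U] by (intro card_distinct) simp
  then have inj: "inj_on lam {..<N}"
    using len by (auto simp: inj_on_def lam_def nth_eq_iff_index_eq)
  fix z assume "z \<in> Delta k U"
  then obtain S :: "nat \<Rightarrow> nat set" where S: "\<forall>i<k. S i \<subseteq> {..<N}" "disjoint_family_on S {..<k}"
    "\<forall>i<k. z \<in> convex hull (lam ` S i)"
    using U by (auto simp: Delta_def eigval_hull_def lam_def[abs_def])
  have "\<exists>c :: nat \<Rightarrow> real. (\<forall>j. 0 \<le> c j) \<and> (\<forall>j. j \<notin> S i \<longrightarrow> c j = 0) \<and>
      (\<Sum>j<N. c j) = 1 \<and> (\<Sum>j<N. of_real (c j) * lam j) = z" if "i < k" for i
    using convex_hull_image_coeffs[OF inj, of "S i" z] S(1,3) that by metis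
  then obtain c :: "nat \<Rightarrow> nat \<Rightarrow> real" where c: "\<And>i j. i < k \<Longrightarrow> 0 \<le> c i j"
    "\<And>i j. i < k \<Longrightarrow> j \<notin> S i \<Longrightarrow> c i j = 0" "\<And>i. i < k \<Longrightarrow> (\<Sum>j<N. c i j) = 1"
    "\<And>i. i < k \<Longrightarrow> (\<Sum>j<N. of_real (c i j) * lam j) = z"
    by metis
  define C where "C = mat N k (\<lambda>(j, i). complex_of_real (sqrt (c i j)))"
  have C: "C \<in> carrier_mat N k" by (simp add: C_def)
  note C' = mat_adjoint_carrier[OF C]
  have C_index: "C $$ (j, i) = of_real (sqrt (c i j))" "mat_adjoint C $$ (i, j) = of_real (sqrt (c i j))"
    if "i < k" "j < N" for i j
    using that by (simp_all add: mat_adjoint_index[OF C]) (simp_all add: C_def)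
  \<comment> \<open>Columns with disjoint supports have products vanishing entry by entry. This
    gives both orthonormality and the zero off-diagonal entries of the compression.\<close>
  have C_prod: "mat_adjoint C $$ (i, j) * C $$ (j, l) = (if i = l then of_real (c i j) else 0)"
    if "i < k" "l < k" "j < N" for i j l
  proof (cases "i = l")
    case True
    then show ?thesis
      using that c(1)[of i j] by (simp add: C_index flip: of_real_mult)
  next
    case False
    then have "j \<notin> S i \<or> j \<notin> S l" using disjoint_family_onD[OF S(2)] that by blast
    then show ?thesis
      using that c(2) False by (auto simp: C_index)
  qed
  have CC: "mat_adjoint C * C = 1\<^sub>m k"
  proof (rule eq_matI)
    fix i l assume "i < dim_row (1\<^sub>m k :: complex mat)" "l < dim_col (1\<^sub>m k :: complex mat)"
    then have il: "i < k" "l < k" by auto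
    show "(mat_adjoint C * C) $$ (i, l) = 1\<^sub>m k $$ (i, l)"
      unfolding mat_mult_index[OF C' C il]
      using il c(3)[OF il(2)] by (simp add: C_prod flip: of_real_sum)
  qed (use carrier_matD[OF C] carrier_matD[OF C'] in auto)
  have DC: "?D * C \<in> carrier_mat N k" using mult_carrier_mat[OF D C] .
  have CDC: "mat_adjoint C * (?D * C) = z \<cdot>\<^sub>m 1\<^sub>m k"
  proof (rule eq_matI)
    fix i l assume "i < dim_row (z \<cdot>\<^sub>m 1\<^sub>m k)" "l < dim_col (z \<cdot>\<^sub>m 1\<^sub>m k)"
    then have il: "i < k" "l < k" by auto
    have "(mat_adjoint C * (?D * C)) $$ (i, l) =
        (\<Sum>j<N. mat_adjoint C $$ (i, j) * C $$ (j, l) * lam j)"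
      unfolding mat_mult_index[OF C' DC il]
      using il by (intro sum.cong) (auto simp: mat_diag_mult_left[OF C])
    also have "\<dots> = (z \<cdot>\<^sub>m 1\<^sub>m k) $$ (i, l)"
      using il c(4)[OF il(2)] by (simp add: C_prod)
    finally show "(mat_adjoint C * (?D * C)) $$ (i, l) = (z \<cdot>\<^sub>m 1\<^sub>m k) $$ (i, l)" .
  qed (use carrier_matD[OF C'] carrier_matD[OF DC] in auto)
  define B where "B = V * C"
  have B: "B \<in> carrier_mat N k" unfolding B_def by (rule mult_carrier_mat[OF V C])
  note B' = mat_adjoint_carrier[OF B]
  have adjB_mult: "mat_adjoint B * (V * X) = mat_adjoint C * X" if X: "X \<in> carrier_mat N k" for X
  proof -
    have "mat_adjoint B * (V * X) = mat_adjoint C * (mat_adjoint V * (V * X))"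
      unfolding B_def mat_adjoint_mult[OF V C]
      by (rule assoc_mult_mat[OF C' V' mult_carrier_mat[OF V X]])
    also have "mat_adjoint V * (V * X) = X"
      using assoc_mult_mat[OF V' V X] VV X by simp
    finally show ?thesis .
  qed
  have BB: "mat_adjoint B * B = 1\<^sub>m k"
    using adjB_mult[OF C] CC by (simp add: B_def)
  have UB: "U * B = V * (?D * C)"
    unfolding B_def using assoc_mult_mat[OF U V C] assoc_mult_mat[OF V D C] UV by simp
  have UB_c: "U * B \<in> carrier_mat N k" by (rule mult_carrier_mat[OF U B])
  have BUB: "mat_adjoint B * (U * B) = z \<cdot>\<^sub>m 1\<^sub>m k"
    unfolding UB adjB_mult[OF DC] by (rule CDC)
  let ?P = "B * mat_adjoint B"
  have P: "?P \<in> carrier_mat N N" by (rule mult_carrier_mat[OF B B'])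
  have "?P * U * ?P = (?P * U * B) * mat_adjoint B"
    by (rule assoc_mult_mat[OF mult_carrier_mat[OF P U] B B', symmetric])
  also have "?P * U * B = B * (mat_adjoint B * (U * B))"
    using assoc_mult_mat[OF P U B] assoc_mult_mat[OF B B' UB_c] by simp
  also have "\<dots> = z \<cdot>\<^sub>m B"
    unfolding BUB using mult_smult_distrib[OF B one_carrier_mat] B by simp
  also have "(z \<cdot>\<^sub>m B) * mat_adjoint B = z \<cdot>\<^sub>m ?P"
    by (rule mult_smult_assoc_mat[OF B B'])
  finally have "?P * U * ?P = z \<cdot>\<^sub>m ?P" .
  then show "z \<in> higher_rank_numerical_range k U"
    using isometry_range_projection[OF B BB] P U
    by (auto simp: higher_rank_numerical_range_def)
qed

section \<open>Convex combinations from compressions\<close>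

lemma adjoint_mult_column:
  fixes W X :: "complex mat"
  assumes "W \<in> carrier_mat n 1" "X \<in> carrier_mat n 1"
  shows "(mat_adjoint W * X) $$ (0, 0) = (\<Sum>j<n. cnj (W $$ (j, 0)) * X $$ (j, 0))"
  using mat_mult_index[OF mat_adjoint_carrier[OF assms(1)] assms(2), of 0 0]
  by (simp add: mat_adjoint_index[OF assms(1)])

text \<open>For each \<open>S\<close> there is a nonzero \<open>X\<close> in the range of
  \<open>P\<close> whose eigenbasis coordinates vanish outside \<open>S\<close>. Its Rayleigh
  quotient is \<open>z\<close>, and it is also the convex combination of eigenvalues weighted by the
  normalised squared moduli of these coordinates.\<close>

lemma higher_rank_numerical_range_subset_Omega:
  assumes U: "U \<in> carrier_mat N N" and unitary: "unitary_mat U" and card: "card (spectrum U) = N"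
    and k: "1 \<le> k" "k \<le> N"
  shows "higher_rank_numerical_range k U \<subseteq> Omega k U"
proof
  define lam where "lam j = eigval_list U ! j" for j
  let ?D = "mat_diag N lam"
  have D: "?D \<in> carrier_mat N N" by simp
  obtain V where V: "V \<in> carrier_mat N N" and VV: "V * mat_adjoint V = 1\<^sub>m N"
    and VV': "mat_adjoint V * V = 1\<^sub>m N" and UV: "U * V = V * ?D"
    using unitary_diagonalization[OF U unitary card] by (auto simp: lam_def[abs_def])
  note V' = mat_adjoint_carrier[OF V]
  fix z assume "z \<in> higher_rank_numerical_range k U"
  then obtain P where P: "P \<in> carrier_mat N N" "orthogonal_projection P"
    "vec_space.rank N P = k" "P * U * P = z \<cdot>\<^sub>m P"
    using U by (auto simp: higher_rank_numerical_range_def)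
  have PP: "P * P = P" "mat_adjoint P = P" using P(2) by (auto simp: orthogonal_projection_def)
  obtain B where B: "B \<in> carrier_mat N k" "set (cols B) \<subseteq> set (cols P)"
    "\<And>Y. Y \<in> carrier_mat k 1 \<Longrightarrow> B * Y = 0\<^sub>m N 1 \<Longrightarrow> Y = 0\<^sub>m k 1"
    using vec_space.rank_factorization[OF P(1)] unfolding P(3) by metis
  have PB: "P * B = B" by (rule idempotent_mult_cols[OF P(1) PP(1) B(1,2)])
  have "z \<in> convex hull (lam ` S)" if S: "S \<subseteq> {..<N}" "card S = N - k + 1" for S
  proof -
    define ts where "ts = sorted_list_of_set ({..<N} - S)"
    have "card ({..<N} - S) = k - 1"
      using S k finite_subset[OF S(1)] by (subst card_Diff_subset) auto
    then have ts: "set ts = {..<N} - S" "length ts = k - 1" by (auto simp: ts_def)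
    have V'B: "mat_adjoint V * B \<in> carrier_mat N k" by (rule mult_carrier_mat[OF V' B(1)])
    \<comment> \<open>The \<open>k - 1\<close> coordinate rows outside \<open>S\<close>, against
      \<open>k\<close> columns, leave a nonzero kernel vector; this is where the size
      \<open>N - k + 1\<close> enters.\<close>
    define C where "C = mat (k - 1) k (\<lambda>(a, l). (mat_adjoint V * B) $$ (ts ! a, l))"
    have C: "C \<in> carrier_mat (k - 1) k" by (simp add: C_def)
    obtain Y where Y: "Y \<in> carrier_mat k 1" "Y \<noteq> 0\<^sub>m k 1" "C * Y = 0\<^sub>m (k - 1) 1"
      using wide_mat_kernel[OF C] k by auto
    define X where "X = B * Y"
    have X: "X \<in> carrier_mat N 1" unfolding X_def by (rule mult_carrier_mat[OF B(1) Y(1)])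
    have PX: "P * X = X" unfolding X_def using assoc_mult_mat[OF P(1) B(1) Y(1)] PB by simp
    define W where "W = mat_adjoint V * X"
    have W: "W \<in> carrier_mat N 1" unfolding W_def by (rule mult_carrier_mat[OF V' X])
    have VW: "V * W = X" unfolding W_def using assoc_mult_mat[OF V V' X] VV X by simp
    note X' = mat_adjoint_carrier[OF X] and W' = mat_adjoint_carrier[OF W]
    have W0: "W $$ (j, 0) = 0" if j: "j < N" "j \<notin> S" for j
    proof -
      obtain a where a: "a < k - 1" "ts ! a = j" using ts j by (metis DiffI in_set_conv_nth lessThan_iff)
      have "W = (mat_adjoint V * B) * Y"
        unfolding W_def X_def using assoc_mult_mat[OF V' B(1) Y(1)] by simp
      then have "W $$ (j, 0) = (\<Sum>l<k. (mat_adjoint V * B) $$ (j, l) * Y $$ (l, 0))"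
        using mat_mult_index[OF V'B Y(1) j(1)] by simp
      also have "\<dots> = (C * Y) $$ (a, 0)"
        using mat_mult_index[OF C Y(1) a(1), of 0] a by (simp add: C_def)
      also have "\<dots> = 0" using Y(3) a(1) by simp
      finally show ?thesis .
    qed
    define s where "s = (\<Sum>j<N. (cmod (W $$ (j, 0)))\<^sup>2)"
    \<comment> \<open>If \<open>W\<close> vanished, so would \<open>X = B * Y\<close>, contrary to
      the trivial kernel of \<open>B\<close>.\<close>
    have "W \<noteq> 0\<^sub>m N 1"
      using VW V B(3)[OF Y(1)] Y(2) by (auto simp: X_def)
    then have "\<exists>j<N. W $$ (j, 0) \<noteq> 0"
      using carrier_matD[OF W] by (metis eq_matI index_zero_mat less_one)
    then obtain m where m: "m < N" "W $$ (m, 0) \<noteq> 0" by blast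
    then have s: "0 < s" unfolding s_def by (intro sum_pos2[of _ m]) auto
    have UX: "U * X = V * (?D * W)"
      using assoc_mult_mat[OF U V W] assoc_mult_mat[OF V D W] UV VW by simp
    have DW: "?D * W \<in> carrier_mat N 1" by (rule mult_carrier_mat[OF D W])
    have UX_c: "U * X \<in> carrier_mat N 1" by (rule mult_carrier_mat[OF U X])
    have adjX: "mat_adjoint X * Z = mat_adjoint W * (mat_adjoint V * Z)" if "Z \<in> carrier_mat N 1" for Z
      unfolding VW[symmetric] mat_adjoint_mult[OF V W] by (rule assoc_mult_mat[OF W' V' that])
    have adjX': "mat_adjoint X * P = mat_adjoint X"
      using mat_adjoint_mult[OF P(1) X] PX PP(2) by simp
    \<comment> \<open>Since the self-adjoint \<open>P\<close> fixes \<open>X\<close>, it can be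
      inserted on both sides of \<open>U\<close>, and \<open>P * U * P\<close> acts on
      \<open>X\<close> as \<open>z\<close>.\<close>
    have "mat_adjoint W * (?D * W) = mat_adjoint X * (U * X)"
      unfolding adjX[OF UX_c] unfolding UX assoc_mult_mat[OF V' V DW, symmetric] VV' left_mult_one_mat[OF DW] ..
    also have "\<dots> = mat_adjoint X * (P * (U * X))"
      using assoc_mult_mat[OF X' P(1) UX_c] adjX' by simp
    also have "P * (U * X) = (P * U * P) * X"
      using assoc_mult_mat[OF mult_carrier_mat[OF P(1) U] P(1) X] assoc_mult_mat[OF P(1) U X] PX by simp
    also have "\<dots> = z \<cdot>\<^sub>m X"
      unfolding P(4) using mult_smult_assoc_mat[OF P(1) X] PX by simp
    also have "mat_adjoint X * (z \<cdot>\<^sub>m X) = z \<cdot>\<^sub>m (mat_adjoint X * X)"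
      by (rule mult_smult_distrib[OF X' X])
    also have "mat_adjoint X * X = mat_adjoint W * W"
      unfolding adjX[OF X] by (simp add: W_def)
    finally have "(mat_adjoint W * (?D * W)) $$ (0, 0) = z * (mat_adjoint W * W) $$ (0, 0)"
      using carrier_matD[OF W] carrier_matD[OF W'] by simp
    moreover have "(mat_adjoint W * W) $$ (0, 0) = of_real s"
      unfolding adjoint_mult_column[OF W W] s_def
      by (simp add: complex_norm_square mult.commute del: of_real_power)
    moreover have "(mat_adjoint W * (?D * W)) $$ (0, 0) =
        (\<Sum>j<N. of_real ((cmod (W $$ (j, 0)))\<^sup>2) * lam j)"
      unfolding adjoint_mult_column[OF W DW]
      by (intro sum.cong)
        (auto simp: mat_diag_mult_left[OF W] complex_norm_square simp del: of_real_power)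
    ultimately have "z * of_real s = (\<Sum>j<N. of_real ((cmod (W $$ (j, 0)))\<^sup>2) * lam j)" by simp
    also have "\<dots> = (\<Sum>j\<in>S. of_real ((cmod (W $$ (j, 0)))\<^sup>2) * lam j)"
      using S(1) W0 by (intro sum.mono_neutral_right) auto
    finally have "z = (\<Sum>j\<in>S. of_real ((cmod (W $$ (j, 0)))\<^sup>2) * lam j) / of_real s"
      using s by (simp add: field_simps)
    also have "\<dots> = (\<Sum>j\<in>S. ((cmod (W $$ (j, 0)))\<^sup>2 / s) *\<^sub>R lam j)"
      by (simp add: sum_divide_distrib scaleR_conv_of_real)
    also have "\<dots> \<in> convex hull (lam ` S)"
    proof (rule convex_sum)
      have "(\<Sum>j\<in>S. (cmod (W $$ (j, 0)))\<^sup>2) = s"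
        unfolding s_def using S(1) W0 by (intro sum.mono_neutral_left) auto
      then show "(\<Sum>j\<in>S. (cmod (W $$ (j, 0)))\<^sup>2 / s) = 1"
        using s by (simp flip: sum_divide_distrib)
    qed (use S(1) finite_subset s in \<open>auto intro: hull_inc\<close>)
    finally show ?thesis .
  qed
  then show "z \<in> Omega k U"
    using U by (auto simp: Omega_def eigval_hull_def lam_def[abs_def])
qed

text \<open>Translation by \<open>- z\<close> moves the question to the origin, where the depth
  argument applies to the eigenvalues as a family indexed by their positions.\<close>

lemma Omega_subset_Delta:
  assumes U: "U \<in> carrier_mat N N" and N: "3 * k \<le> N"
  shows "Omega k U \<subseteq> Delta k U"
proof
  define lam where "lam j = eigval_list U ! j" for j
  fix z assume "z \<in> Omega k U"
  then have "z \<in> convex hull (lam ` S)" if "S \<subseteq> {..<N}" "card S = card {..<N} - k + 1" for S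
    using that U by (auto simp: Omega_def eigval_hull_def lam_def[abs_def])
  then have "half_plane_depth_ge (\<lambda>j. lam j - z) {..<N} k"
    using N by (intro half_plane_depth_geI) auto
  then obtain S :: "nat \<Rightarrow> nat set" where S: "\<forall>i<k. S i \<subseteq> {..<N}" "disjoint_family_on S {..<k}"
    "\<forall>i<k. 0 \<in> convex hull ((\<lambda>j. lam j - z) ` S i)"
    using disjoint_hulls[of "{..<N}" k "\<lambda>j. lam j - z"] N by auto
  have "z \<in> convex hull (lam ` S i)" if "i < k" for i
  proof -
    have "(\<lambda>j. lam j - z) ` S i = (+) (- z) ` lam ` S i" by (auto simp: image_image)
    then have "0 \<in> (+) (- z) ` (convex hull (lam ` S i))"
      using S(3) that unfolding convex_hull_translation[symmetric] by metis
    then show ?thesis by auto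
  qed
  then show "z \<in> Delta k U"
    using S(1,2) U by (auto simp: Delta_def eigval_hull_def lam_def[abs_def])
qed

theorem theorem5p2:
  fixes k N :: nat
  assumes "k \<ge> 1" and "N \<ge> 3 * k"
  shows "(\<forall>U \<in> carrier_mat N N.
            unitary_mat U \<and> card (spectrum U) = N \<longrightarrow> Omega k U = Delta k U) \<and>
         (\<forall>U \<in> carrier_mat N N.
            unitary_mat U \<and> card (spectrum U) = N \<longrightarrow>
              higher_rank_numerical_range k U = Omega k U)"
proof -
  \<comment> \<open>The three inclusions close a cycle, so all three sets coincide.\<close>
  have sub: "Omega k U \<subseteq> Delta k U" "Delta k U \<subseteq> higher_rank_numerical_range k U"
    "higher_rank_numerical_range k U \<subseteq> Omega k U"
    if "U \<in> carrier_mat N N" "unitary_mat U" "card (spectrum U) = N" for U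
    using that assms Omega_subset_Delta Delta_subset_higher_rank_numerical_range
      higher_rank_numerical_range_subset_Omega[of U N k] by auto
  then show ?thesis by (metis subset_antisym subset_trans)
qed

end
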